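(* Let $d\geq 1$. Every infinite $d$-ary word $w$ with rationally independent letter frequencies and complexity $p_w(n)=(d-1)n+1$ for all $n\in\mathbb{N}$ is dendric.
   Context: $\mathbb{N}$ contains $0$. An infinite $d$-ary word is a sequence $w\in\{1,\ldots,d\}^{\mathbb{N}}$ in which all $d$ letters actually occur. A factor of length $n$ of $w$ is a finite word of length $n$ occurring in $w$ as a block of $n$ consecutive letters; $\mathcal{L}_n(w)$ is the set of factors of length $n$ of $w$ (with $\mathcal{L}_0(w)$ consisting of the empty word), and $p_w(n)=\mathrm{card}(\mathcal{L}_n(w))$ is the complexity of $w$. The frequency of the letter $a$ in $w$ is, if it exists, the limit $f_a=\lim_{n\to\infty}|\mathrm{pref}_n(w)|_a/n$, where $|\mathrm{pref}_n(w)|_a$ is the number of occurrences of $a$ among the first $n$ letters of $w$. The word $w$ has rationally independent letter frequencies if the frequencies $f_1,\ldots,f_d$ all exist and are linearly independent over $\mathbb{Q}$. For a factor $u\in\mathcal{L}_n(w)$, the extension graph of $u$ is the undirected bipartite graph with vertex set the disjoint union $L\sqcup R$, where $L$ is the set of letters $a$ with $au\in\mathcal{L}_{n+1}(w)$ and $R$ is the set of letters $b$ with $ub\in\mathcal{L}_{n+1}(w)$, and with an edge between $a\in L$ and $b\in R$ if and only if $aub\in\mathcal{L}_{n+2}(w)$. The word $w$ is dendric if the extension graph of each of its factors (including the empty word) is a tree, i.e. connected and acyclic. *)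

theory Defs
  imports
    Complex_Main
    "HOL-Library.Omega_Words_Fun"
    "Graph_Theory.Digraph_Component"
begin

text \<open>The letters are the natural numbers \<open>1, \<dots>, d\<close>, and all of them have to occur.\<close>

definition infinite_dary_word :: "nat \<Rightarrow> nat word \<Rightarrow> bool" where
  "infinite_dary_word d w \<longleftrightarrow> range w = {1..d}"

definition factors :: "'a word \<Rightarrow> nat \<Rightarrow> 'a list set" where
  "factors w n = {subsequence w i (i + n) | i. True}"

definition complexity :: "'a word \<Rightarrow> nat \<Rightarrow> nat" where
  "complexity w n = card (factors w n)"

lemma finite_factors:
  assumes "finite (range w)"
  shows "finite (factors w n)"
proof (rule finite_subset)
  show "factors w n \<subseteq> {u. set u \<subseteq> range w \<and> length u = n}"
    by (auto simp: factors_def subsequence_def)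
  show "finite {u. set u \<subseteq> range w \<and> length u = n}"
    using assms by (rule finite_lists_length_eq)
qed

definition prefix_frequency :: "'a word \<Rightarrow> 'a \<Rightarrow> nat \<Rightarrow> real" where
  "prefix_frequency w a n = real (count_list (subsequence w 0 n) a) / real n"

definition has_frequency :: "'a word \<Rightarrow> 'a \<Rightarrow> bool" where
  "has_frequency w a \<longleftrightarrow> convergent (prefix_frequency w a)"

definition frequency :: "'a word \<Rightarrow> 'a \<Rightarrow> real" where
  "frequency w a = lim (prefix_frequency w a)"

text \<open>Independence is meant for the family \<open>(f\<^sub>1, \<dots>, f\<^sub>d)\<close>, not for the set of its values;
  hence the injectivity condition.\<close>

definition rationally_independent_frequencies :: "nat \<Rightarrow> nat word \<Rightarrow> bool" where
  "rationally_independent_frequencies d w \<longleftrightarrow>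
     (\<forall>a\<in>{1..d}. has_frequency w a) \<and>
     inj_on (frequency w) {1..d} \<and>
     module.independent (\<lambda>q x. real_of_rat q * x) (frequency w ` {1..d})"

lemma module_real_over_rat: "module (\<lambda>q x. real_of_rat q * x)"
  by unfold_locales (auto simp: algebra_simps of_rat_add of_rat_mult)

lemma rationally_independent_family_iff:
  fixes f :: "'i \<Rightarrow> real"
  assumes I: "finite I"
  shows "inj_on f I \<and> module.independent (\<lambda>q x. real_of_rat q * x) (f ` I) \<longleftrightarrow>
    (\<forall>q. (\<Sum>i\<in>I. real_of_rat (q i) * f i) = 0 \<longrightarrow> (\<forall>i\<in>I. q i = 0))"
    (is "?inj \<and> ?ind \<longleftrightarrow> ?fam")
proof
  interpret module "\<lambda>q x. real_of_rat q * x" by (rule module_real_over_rat)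
  assume *: "?inj \<and> ?ind"
  show ?fam
  proof (intro allI impI ballI)
    fix q i assume s: "(\<Sum>i\<in>I. real_of_rat (q i) * f i) = 0" and i: "i \<in> I"
    define u where "u = (\<lambda>v. q (the_inv_into I f v))"
    have u: "u (f j) = q j" if "j \<in> I" for j
      using * that by (simp add: u_def the_inv_into_f_f)
    have "(\<Sum>v\<in>f ` I. real_of_rat (u v) * v) = 0"
      using * s u by (simp add: sum.reindex)
    then have "u (f i) = 0"
      using independentD[of "f ` I" "f ` I" u "f i"] * I i by auto
    then show "q i = 0" using u i by simp
  qed
next
  interpret module "\<lambda>q x. real_of_rat q * x" by (rule module_real_over_rat)
  assume fam: ?fam
  have inj: ?inj
  proof (rule inj_onI, rule ccontr)
    fix i j assume ij: "i \<in> I" "j \<in> I" "f i = f j" "i \<noteq> j"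
    define q where "q = (\<lambda>k. if k = i then 1 else if k = j then -1 else 0 :: rat)"
    have "(\<Sum>k\<in>I. real_of_rat (q k) * f k) = (\<Sum>k\<in>{i, j}. real_of_rat (q k) * f k)"
      using I ij by (intro sum.mono_neutral_right) (auto simp: q_def)
    also have "\<dots> = 0" using ij by (simp add: q_def)
    finally have "q i = 0" using fam ij by blast
    then show False by (simp add: q_def)
  qed
  moreover have ?ind
  proof
    assume "dependent (f ` I)"
    then obtain u where u: "\<exists>v\<in>f ` I. u v \<noteq> 0" "(\<Sum>v\<in>f ` I. real_of_rat (u v) * v) = 0"
      using I by (auto simp: dependent_finite)
    then have "(\<Sum>i\<in>I. real_of_rat (u (f i)) * f i) = 0"
      using inj by (simp add: sum.reindex)
    then show False using fam[rule_format, of "\<lambda>i. u (f i)"] u by auto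
  qed
  ultimately show "?inj \<and> ?ind" ..
qed

definition left_extensions :: "'a word \<Rightarrow> 'a list \<Rightarrow> 'a set" where
  "left_extensions w u = {a. a # u \<in> factors w (length u + 1)}"

definition right_extensions :: "'a word \<Rightarrow> 'a list \<Rightarrow> 'a set" where
  "right_extensions w u = {b. u @ [b] \<in> factors w (length u + 1)}"

text \<open>An undirected graph is represented by its symmetric digraph: an edge between \<open>x\<close> and \<open>y\<close>
  is the pair of opposite arcs \<open>(x, y)\<close> and \<open>(y, x)\<close>. The two sides of the bipartition are
  separated by \<open>Inl\<close> and \<open>Inr\<close>.\<close>

definition extension_edges :: "'a word \<Rightarrow> 'a list \<Rightarrow> (('a + 'a) \<times> ('a + 'a)) set" where
  "extension_edges w u =
     {(Inl a, Inr b) | a b. a \<in> left_extensions w u \<and> b \<in> right_extensions w u \<and>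
        a # u @ [b] \<in> factors w (length u + 2)}"

definition extension_graph :: "'a word \<Rightarrow> 'a list \<Rightarrow> ('a + 'a) pair_pre_digraph" where
  "extension_graph w u =
     \<lparr> pverts = Inl ` left_extensions w u \<union> Inr ` right_extensions w u,
       parcs = extension_edges w u \<union> (extension_edges w u)\<inverse> \<rparr>"

lemma pair_graph_extension_graph:
  assumes "finite (range w)"
  shows "pair_graph (extension_graph w u)"
proof -
  have range: "set v \<subseteq> range w" if "v \<in> factors w n" for v n
    using that by (auto simp: factors_def)
  have "left_extensions w u \<subseteq> range w"
    using range by (fastforce simp: left_extensions_def)
  moreover have "right_extensions w u \<subseteq> range w"
    using range by (fastforce simp: right_extensions_def)
  ultimately have fin: "finite (pverts (extension_graph w u))"
    using assms by (auto simp: extension_graph_def intro: finite_subset)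
  have sub: "parcs (extension_graph w u) \<subseteq>
      pverts (extension_graph w u) \<times> pverts (extension_graph w u)"
    by (auto simp: extension_graph_def extension_edges_def)
  have "finite (parcs (extension_graph w u))"
    using sub by (rule finite_subset) (simp add: fin)
  with fin sub show ?thesis
    by unfold_locales
      (auto simp: extension_graph_def extension_edges_def symmetric_def intro!: symI)
qed

text \<open>The library predicate \<open>tree\<close> excludes every directed cycle, including the closed walk of
  length two that runs along an edge and back. In the symmetric digraph of a simple undirected
  graph, the cycles of the graph are the directed cycles with at least three arcs.\<close>

definition undirected_acyclic :: "'v pair_pre_digraph \<Rightarrow> bool" where
  "undirected_acyclic G \<longleftrightarrow> \<not> (\<exists>p. pre_digraph.cycle (with_proj G) p \<and> 3 \<le> length p)"

definition undirected_tree :: "'v pair_pre_digraph \<Rightarrow> bool" where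
  "undirected_tree G \<longleftrightarrow> Digraph_Component.connected (with_proj G) \<and> undirected_acyclic G"

definition dendric :: "'a word \<Rightarrow> bool" where
  "dendric w \<longleftrightarrow> (\<forall>n. \<forall>u\<in>factors w n. undirected_tree (extension_graph w u))"

end

theory Submission
  imports Defs "HOL-Library.Function_Algebras"
begin

text \<open>Consider the linear map sending a pair \<open>(h, q)\<close>, with \<open>h\<close> a rational function on the factors of
  length \<open>n + 1\<close> and \<open>q\<close> one on the letters, to the function
  \<open>e \<mapsto> q (hd e) + h (tl e) - h (butlast e)\<close> on the factors of length \<open>n + 2\<close>. If the image is
  \<open>0\<close>, then \<open>h\<close> telescopes along \<open>w\<close>, so the partial sums of \<open>q\<close> along \<open>w\<close> are bounded; hence
  \<open>\<Sum>a. q a * f\<^sub>a = 0\<close>, so \<open>q = 0\<close> by rational independence and \<open>h\<close> is constant. By the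
  complexity assumption the map is therefore surjective. Restricted to the words \<open>a u b\<close> this says
  that every function on the edges of the extension graph of \<open>u\<close> is a difference of vertex
  potentials. So no edge lies on a cycle, and the number of edges is at most the number of vertices
  minus the number of components. Since the second difference of the complexity vanishes, these
  bounds, summed over all \<open>u\<close> of length \<open>n\<close>, leave room for one component only.\<close>

section \<open>Dimension counts for finite linear systems\<close>

lemma vector_space_fun:
  "vector_space (\<lambda>(c::'k::field) (f::'y \<Rightarrow> 'k). (\<lambda>y. c * f y))"
  by unfold_locales (auto simp: fun_eq_iff algebra_simps)

lemma sum_fun_apply: "(\<Sum>x\<in>A. f x) y = (\<Sum>x\<in>A. f x y)"
  by (induction A rule: infinite_finite_induct) auto

lemma sum_unit_fun:
  fixes f :: "'y \<Rightarrow> 'k::field"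
  assumes "finite Y" "\<And>y. y \<notin> Y \<Longrightarrow> f y = 0"
  shows "(\<Sum>z\<in>Y. (\<lambda>y. f z * of_bool (y = z))) = f"
proof
  fix y
  have "(\<Sum>z\<in>Y. f z * of_bool (y = z)) = (\<Sum>z\<in>Y. if y = z then f z else 0)"
    by (intro sum.cong) auto
  also have "\<dots> = f y" using assms by (auto simp: sum.delta')
  finally show "(\<Sum>z\<in>Y. (\<lambda>y. f z * of_bool (y = z))) y = f y"
    by (simp add: sum_fun_apply)
qed

text \<open>The rows of \<open>M\<close>, cut off outside \<open>Y\<close>, span the
  \<open>card Y\<close> independent unit functions of \<open>Y\<close>, so there are at least as
  many rows.\<close>

lemma card_le_if_surjective_system:
  fixes M :: "'x \<Rightarrow> 'y \<Rightarrow> 'k::field"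
  assumes X: "finite X" and Y: "finite Y"
    and surj: "\<And>g. \<exists>c. \<forall>y\<in>Y. (\<Sum>x\<in>X. c x * M x y) = g y"
  shows "card Y \<le> card X"
proof -
  interpret vector_space "\<lambda>(c::'k) (f::'y \<Rightarrow> 'k). (\<lambda>y. c * f y)"
    by (rule vector_space_fun)
  \<comment> \<open>The hypothesis controls values on \<open>Y\<close> only; with zero outside, a
    linear relation on \<open>Y\<close> becomes an equality of functions.\<close>
  define v where "v x = (\<lambda>y. if y \<in> Y then M x y else 0)" for x
  define e :: "'y \<Rightarrow> 'y \<Rightarrow> 'k" where "e z = (\<lambda>y. of_bool (y = z))" for z
  have inj: "inj_on e Y"
    by (rule inj_onI) (metis e_def of_bool_eq_iff)
  have "independent (e ` Y)"
  proof (rule independent_if_scalars_zero)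
    show "finite (e ` Y)" using Y by simp
    fix f x assume *: "(\<Sum>x\<in>e ` Y. (\<lambda>y. f x * x y)) = 0" and "x \<in> e ` Y"
    then obtain z where z: "z \<in> Y" "x = e z" by auto
    have "0 = (\<Sum>z\<in>Y. (\<lambda>y. f (e z) * e z y)) z"
      using * by (simp add: sum.reindex[OF inj])
    also have "\<dots> = (\<Sum>a\<in>Y. f (e a) * of_bool (z = a))"
      by (simp add: sum_fun_apply e_def)
    also have "\<dots> = (\<Sum>a\<in>Y. if z = a then f (e a) else 0)"
      by (intro sum.cong) auto
    also have "\<dots> = f x" using Y z by (simp add: sum.delta')
    finally show "f x = 0" by simp
  qed
  moreover have "e ` Y \<subseteq> span (v ` X)"
  proof
    fix f assume "f \<in> e ` Y"
    then obtain z where z: "z \<in> Y" "f = e z" by auto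
    obtain c where c: "\<forall>y\<in>Y. (\<Sum>x\<in>X. c x * M x y) = e z y" using surj by blast
    have "f = (\<Sum>x\<in>X. (\<lambda>y. c x * v x y))"
    proof
      fix y show "f y = (\<Sum>x\<in>X. (\<lambda>y. c x * v x y)) y"
        using c z by (cases "y \<in> Y") (auto simp: sum_fun_apply v_def e_def)
    qed
    also have "\<dots> \<in> span (v ` X)"
      by (intro span_sum span_scale span_base) auto
    finally show "f \<in> span (v ` X)" .
  qed
  ultimately have "card (e ` Y) \<le> card (v ` X)"
    using independent_span_bound[of "v ` X" "e ` Y"] X by blast
  then show ?thesis
    using card_image[OF inj] card_image_le[OF X, of v] by simp
qed

text \<open>Injectivity makes the rows independent. If \<open>g\<close> were outside their span,
  adding it would give \<open>card X + 1\<close> independent vectors in a space spanned by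
  \<open>card Y\<close> unit functions.\<close>

lemma surjective_if_injective_square_system:
  fixes M :: "'x \<Rightarrow> 'y \<Rightarrow> 'k::field"
  assumes X: "finite X" and Y: "finite Y" and card: "card X = card Y"
    and inj: "\<And>c x. \<forall>y\<in>Y. (\<Sum>x\<in>X. c x * M x y) = 0 \<Longrightarrow> x \<in> X \<Longrightarrow> c x = 0"
  shows "\<exists>c. \<forall>y\<in>Y. (\<Sum>x\<in>X. c x * M x y) = g y"
proof -
  interpret vector_space "\<lambda>(c::'k) (f::'y \<Rightarrow> 'k). (\<lambda>y. c * f y)"
    by (rule vector_space_fun)
  define v where "v x = (\<lambda>y. if y \<in> Y then M x y else 0)" for x
  define e :: "'y \<Rightarrow> 'y \<Rightarrow> 'k" where "e z = (\<lambda>y. of_bool (y = z))" for z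
  have injv: "inj_on v X"
  proof (rule inj_onI, rule ccontr)
    fix a b assume ab: "a \<in> X" "b \<in> X" "v a = v b" "a \<noteq> b"
    \<comment> \<open>Two equal rows would give a nonzero kernel element.\<close>
    define c :: "'x \<Rightarrow> 'k" where "c x = (if x = a then 1 else if x = b then -1 else 0)" for x
    have "(\<Sum>x\<in>X. c x * M x y) = 0" if "y \<in> Y" for y
    proof -
      have "(\<Sum>x\<in>X. c x * M x y) = (\<Sum>x\<in>{a, b}. c x * M x y)"
        using X ab by (intro sum.mono_neutral_right) (auto simp: c_def)
      also have "\<dots> = M a y - M b y" using ab by (simp add: c_def)
      also have "\<dots> = 0" using fun_cong[OF ab(3), of y] that by (simp add: v_def)
      finally show ?thesis .
    qed
    then have "c a = 0" using inj ab by blast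
    then show False by (simp add: c_def)
  qed
  have indep: "independent (v ` X)"
  proof (rule independent_if_scalars_zero)
    show "finite (v ` X)" using X by simp
    fix f x assume *: "(\<Sum>x\<in>v ` X. (\<lambda>y. f x * x y)) = 0" and "x \<in> v ` X"
    then obtain z where z: "z \<in> X" "x = v z" by auto
    have "(\<Sum>x\<in>X. f (v x) * M x y) = 0" if "y \<in> Y" for y
    proof -
      have "0 = (\<Sum>x\<in>X. (\<lambda>y. f (v x) * v x y)) y"
        using * by (simp add: sum.reindex[OF injv])
      then show ?thesis using that by (simp add: sum_fun_apply v_def)
    qed
    then show "f x = 0" using inj[of "\<lambda>x. f (v x)" z] z by blast
  qed
  have supp: "f \<in> span (e ` Y)" if "\<And>y. y \<notin> Y \<Longrightarrow> f y = 0" for f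
  proof -
    have "f = (\<Sum>z\<in>Y. (\<lambda>y. f z * e z y))"
      unfolding e_def using sum_unit_fun[OF Y, of f] that by simp
    also have "\<dots> \<in> span (e ` Y)"
      by (intro span_sum span_scale span_base) auto
    finally show ?thesis .
  qed
  define g' where "g' = (\<lambda>y. if y \<in> Y then g y else 0)"
  have "g' \<in> span (v ` X)"
  proof (rule ccontr)
    assume ng: "g' \<notin> span (v ` X)"
    then have "independent (insert g' (v ` X))"
      using indep by (rule independent_insertI)
    moreover have "insert g' (v ` X) \<subseteq> span (e ` Y)"
      by (auto intro!: supp simp: g'_def v_def)
    ultimately have "card (insert g' (v ` X)) \<le> card (e ` Y)"
      using independent_span_bound[of "e ` Y" "insert g' (v ` X)"] Y by blast
    moreover have "g' \<notin> v ` X" using ng span_base by blast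
    ultimately show False
      using X card_image[OF injv] card_image_le[OF Y, of e] card by simp
  qed
  then obtain u where u: "g' = (\<Sum>x\<in>v ` X. (\<lambda>y. u x * x y))"
    using span_finite[of "v ` X"] X by auto
  then have "g' y = (\<Sum>x\<in>X. u (v x) * v x y)" for y
    by (simp add: sum.reindex[OF injv] sum_fun_apply)
  moreover have "v x y = M x y" if "y \<in> Y" for x y using that by (simp add: v_def)
  ultimately have "\<forall>y\<in>Y. (\<Sum>x\<in>X. u (v x) * M x y) = g y"
    by (metis (no_types, lifting) g'_def sum.cong)
  then show ?thesis by (intro exI[of _ "\<lambda>x. u (v x)"])
qed

section \<open>Potentials, cycles and components of graphs\<close>

text \<open>\<open>M\<close> is the signed incidence matrix. Subtracting from \<sigma> a function
  \<tau> that is constant along arcs and agrees with \<sigma> on \<open>D\<close> keeps all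
  differences, so the vertices in \<open>V - D\<close> alone already yield every function on
  \<open>E\<close>.\<close>

lemma card_arcs_le_if_potentials:
  fixes E :: "('v \<times> 'v) set"
  assumes V: "finite V" and E: "E \<subseteq> V \<times> V" and D: "D \<subseteq> V"
    and pot: "\<And>g :: 'v \<times> 'v \<Rightarrow> rat. \<exists>\<sigma>. \<forall>(s, t)\<in>E. g (s, t) = \<sigma> s - \<sigma> t"
    \<comment> \<open>i.e. \<open>D\<close> meets every connected component at most once\<close>
    and loc: "\<And>\<gamma> :: 'v \<Rightarrow> rat. \<exists>\<tau>. (\<forall>(s, t)\<in>E. \<tau> s = \<tau> t) \<and> (\<forall>x\<in>D. \<tau> x = \<gamma> x)"
  shows "card E + card D \<le> card V"
proof -
  have finE: "finite E" using V E finite_subset by blast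
  define M :: "'v \<Rightarrow> 'v \<times> 'v \<Rightarrow> rat" where
    "M x e = of_bool (x = fst e) - of_bool (x = snd e)" for x e
  have "card E \<le> card (V - D)"
  proof (rule card_le_if_surjective_system[where M = M])
    fix g :: "'v \<times> 'v \<Rightarrow> rat"
    obtain \<sigma> where \<sigma>: "\<forall>(s, t)\<in>E. g (s, t) = \<sigma> s - \<sigma> t" using pot by blast
    obtain \<tau> where \<tau>: "\<forall>(s, t)\<in>E. \<tau> s = \<tau> t" "\<forall>x\<in>D. \<tau> x = \<sigma> x" using loc by blast
    define c where "c x = \<sigma> x - \<tau> x" for x
    have "(\<Sum>x\<in>V - D. c x * M x e) = g e" if "e \<in> E" for e
    proof -
      obtain s t where e: "e = (s, t)" by force
      have st: "s \<in> V" "t \<in> V" using E that e by auto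
      have "(\<Sum>x\<in>V - D. c x * M x e) = (\<Sum>x\<in>V. c x * M x e)"
        using V \<tau> by (intro sum.mono_neutral_left) (auto simp: c_def)
      also have "\<dots> = (\<Sum>x\<in>V. (if x = s then c x else 0) - (if x = t then c x else 0))"
        by (intro sum.cong) (auto simp: M_def e)
      also have "\<dots> = c s - c t"
        using V st by (simp add: sum_subtractf)
      also have "\<dots> = g e"
      proof -
        have "g (s, t) = \<sigma> s - \<sigma> t" "\<tau> s = \<tau> t" using \<sigma> \<tau>(1) that e by auto
        then show ?thesis by (simp add: c_def e)
      qed
      finally show ?thesis .
    qed
    then show "\<exists>c. \<forall>e\<in>E. (\<Sum>x\<in>V - D. c x * M x e) = g e" by blast
  qed (use V finE in auto)
  also have "\<dots> = card V - card D" using V D by (meson card_Diff_subset finite_subset)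
  finally show ?thesis using card_mono[OF V D] by linarith
qed

text \<open>After its first arc \<open>(r, y)\<close>, a cycle of length at least three returns from
  \<open>y\<close> to \<open>r\<close> without using that edge in either direction. Along this way
  \<sigma> is constant, although it differs at \<open>r\<close> and \<open>y\<close>.\<close>

lemma undirected_acyclic_if_separating_potentials:
  fixes G :: "'v pair_pre_digraph"
  assumes sep: "\<And>x y. (x, y) \<in> parcs G \<Longrightarrow> \<exists>\<sigma> :: 'v \<Rightarrow> rat. \<sigma> x \<noteq> \<sigma> y \<and>
    (\<forall>s t. (s, t) \<in> parcs G \<longrightarrow> (s, t) \<noteq> (x, y) \<longrightarrow> (s, t) \<noteq> (y, x) \<longrightarrow> \<sigma> s = \<sigma> t)"
  shows "undirected_acyclic G"
  unfolding undirected_acyclic_def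
proof clarify
  fix p assume "pre_digraph.cycle (with_proj G) p" and len: "3 \<le> length p"
  then obtain r where aw: "pre_digraph.awalk (with_proj G) r p r"
    and dist: "distinct (tl (pawalk_verts r p))"
    by (auto simp: pre_digraph.cycle_def awalk_verts_with_proj_eq)
  have casp: "pcas r p r" and arcs: "set p \<subseteq> parcs G"
    using aw by (auto simp: pre_digraph.awalk_def cas_with_proj_eq)
  obtain e1 e2 e3 p' where e: "p = e1 # e2 # e3 # p'"
    using len by (auto simp: numeral_3_eq_3 Suc_le_length_iff)
  define y q where "y = snd e1" and "q = e2 # e3 # p'"
  have p: "p = (r, y) # q" using casp e by (cases e1) (auto simp: y_def q_def)
  have cas: "pcas y q r" using casp p by simp
  have verts: "pawalk_verts a q = map fst q @ [b]" if "pcas a q b" for a b and q :: "('v \<times> 'v) list"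
    using that by (induction q arbitrary: a) auto
  have d: "distinct (map fst q @ [r])"
    using dist verts[OF cas] p by simp
  have "(r, y) \<notin> set q" using d by force
  \<comment> \<open>Only \<open>e2\<close> starts at \<open>y\<close>, so the arc would have to be
    \<open>e2\<close>. Then \<open>e3\<close>, which exists because the length is at least three,
    would start at \<open>r\<close>, the final vertex of the cycle.\<close>
  moreover have "(y, r) \<notin> set q"
  proof
    assume "(y, r) \<in> set q"
    moreover have "fst e2 = y" "snd e2 = fst e3" using cas by (auto simp: q_def)
    moreover have "y \<notin> fst ` set (e3 # p')" using d \<open>fst e2 = y\<close> by (auto simp: q_def)
    ultimately have "e2 = (y, r)" by (metis fst_conv image_eqI q_def set_ConsD)
    with \<open>snd e2 = fst e3\<close> d show False by (auto simp: q_def)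
  qed
  moreover obtain \<sigma> :: "'v \<Rightarrow> rat" where \<sigma>: "\<sigma> r \<noteq> \<sigma> y"
    "\<And>s t. (s, t) \<in> parcs G \<Longrightarrow> (s, t) \<noteq> (r, y) \<Longrightarrow> (s, t) \<noteq> (y, r) \<Longrightarrow> \<sigma> s = \<sigma> t"
    using sep[of r y] arcs p by auto
  ultimately have "\<sigma> s = \<sigma> t" if "(s, t) \<in> set q" for s t
    using that arcs p by (metis list.set_intros(2) subsetD)
  moreover have "\<sigma> a = \<sigma> b" if "pcas a q b" "\<And>s t. (s, t) \<in> set q \<Longrightarrow> \<sigma> s = \<sigma> t" for a b q
    using that
  proof (induction q arbitrary: a)
    case (Cons x q)
    have "\<sigma> (snd x) = \<sigma> b" using Cons by auto
    moreover have "\<sigma> (fst x) = \<sigma> (snd x)" using Cons.prems(2)[of "fst x" "snd x"] by simp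
    ultimately show ?case using Cons.prems(1) by simp
  qed simp
  ultimately have "\<sigma> y = \<sigma> r" using cas by blast
  with \<sigma>(1) show False by simp
qed

text \<open>\<open>S\<close> is the set of vertices reachable from \<open>x\<close>; since arcs come
  in opposite pairs, none enters or leaves it. Nonemptiness is assumed because connectedness in the
  library includes it.\<close>

lemma separated_if_not_connected:
  fixes G :: "'v pair_pre_digraph"
  assumes "pair_graph G" "pverts G \<noteq> {}" "\<not> Digraph_Component.connected (with_proj G)"
  obtains x y S where "x \<in> pverts G" "y \<in> pverts G" "x \<in> S" "y \<notin> S"
    "\<And>s t. (s, t) \<in> parcs G \<Longrightarrow> s \<in> S \<longleftrightarrow> t \<in> S"
proof -
  interpret pair_graph G by fact
  have "pverts (mk_symmetric (with_proj G)) = pverts G" by (simp add: mk_symmetric_def)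
  then obtain x y where xy: "x \<in> pverts G" "y \<in> pverts G"
    "\<not> reachable (with_proj (mk_symmetric (with_proj G))) x y"
    using assms(2,3) unfolding Digraph_Component.connected_def strongly_connected_def by auto
  then have "\<not> reachable (with_proj G) x y" using reachable_mk_symmetricI by blast
  note xy = xy(1,2) this
  show thesis
  proof (rule that[of x y "{v. reachable (with_proj G) x v}"])
    fix s t assume st: "(s, t) \<in> parcs G"
    then have ts: "(t, s) \<in> parcs G" using sym_arcs by (auto simp: symmetric_def elim: symE)
    have "reachable (with_proj G) x b" if "reachable (with_proj G) x a" "(a, b) \<in> parcs G" for a b
      by (rule reachable_adj_trans[OF that(1)]) (simp add: that(2))
    with st ts show "s \<in> {v. reachable (with_proj G) x v} \<longleftrightarrow> t \<in> {v. reachable (with_proj G) x v}"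
      by blast
  qed (use xy in auto)
qed

section \<open>Factors, their extensions and the complexity\<close>

lemma subsequence_Cons: "subsequence w i (i + Suc n) = w i # subsequence w (Suc i) (Suc i + n)"
  by (simp add: subsequence_def upt_rec)

lemma subsequence_snoc: "subsequence w i (i + Suc n) = subsequence w i (i + n) @ [w (i + n)]"
  by (simp add: subsequence_def)

lemma length_factors: "u \<in> factors w n \<Longrightarrow> length u = n"
  by (auto simp: factors_def)

lemma subsequence_in_factors [simp]: "subsequence w i (i + n) \<in> factors w n"
  by (auto simp: factors_def)

lemma factorsE:
  assumes "u \<in> factors w n" obtains i where "u = subsequence w i (i + n)"
  using assms by (auto simp: factors_def)

lemma tl_in_factors: "e \<in> factors w (Suc n) \<Longrightarrow> tl e \<in> factors w n"
  by (metis factorsE list.sel(3) subsequence_Cons subsequence_in_factors)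

lemma butlast_in_factors: "e \<in> factors w (Suc n) \<Longrightarrow> butlast e \<in> factors w n"
  by (metis factorsE butlast_snoc subsequence_snoc subsequence_in_factors)

lemma complexity_Suc_right:
  assumes "finite (range w)"
  shows "complexity w (Suc n) = (\<Sum>u\<in>factors w n. card (right_extensions w u))"
proof -
  have fin: "finite (right_extensions w u)" for u
    by (rule finite_surj[OF finite_factors[OF assms], of _ last "length u + 1"])
      (force simp: right_extensions_def)
  have "factors w (Suc n) = (\<lambda>(u, b). u @ [b]) ` Sigma (factors w n) (right_extensions w)"
  proof (intro equalityI subsetI)
    fix e assume e: "e \<in> factors w (Suc n)"
    then have "e = butlast e @ [last e]" using length_factors[OF e] by (cases e rule: rev_cases) auto
    moreover have "butlast e \<in> factors w n" using e by (rule butlast_in_factors)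
    ultimately show "e \<in> (\<lambda>(u, b). u @ [b]) ` Sigma (factors w n) (right_extensions w)"
      using e length_factors[of "butlast e" w n]
      by (intro image_eqI[of _ _ "(butlast e, last e)"]) (auto simp: right_extensions_def)
  qed (auto simp: right_extensions_def dest: length_factors)
  moreover have "inj_on (\<lambda>(u, b). u @ [b]) (Sigma (factors w n) (right_extensions w))"
    by (auto simp: inj_on_def)
  ultimately show ?thesis
    using fin by (simp add: complexity_def card_image finite_factors[OF assms])
qed

lemma complexity_Suc_left:
  assumes "finite (range w)"
  shows "complexity w (Suc n) = (\<Sum>u\<in>factors w n. card (left_extensions w u))"
proof -
  have fin: "finite (left_extensions w u)" for u
    by (rule finite_surj[OF finite_factors[OF assms], of _ hd "length u + 1"])
      (force simp: left_extensions_def)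
  have "factors w (Suc n) = (\<lambda>(u, a). a # u) ` Sigma (factors w n) (left_extensions w)"
  proof (intro equalityI subsetI)
    fix e assume e: "e \<in> factors w (Suc n)"
    then have "e = hd e # tl e" using length_factors[OF e] by (cases e) auto
    moreover have "tl e \<in> factors w n" using e by (rule tl_in_factors)
    ultimately show "e \<in> (\<lambda>(u, a). a # u) ` Sigma (factors w n) (left_extensions w)"
      using e length_factors[of "tl e" w n]
      by (intro image_eqI[of _ _ "(tl e, hd e)"]) (auto simp: left_extensions_def)
  qed (auto simp: left_extensions_def dest: length_factors)
  moreover have "inj_on (\<lambda>(u, a). a # u) (Sigma (factors w n) (left_extensions w))"
    by (auto simp: inj_on_def)
  ultimately show ?thesis
    using fin by (simp add: complexity_def card_image finite_factors[OF assms])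
qed

text \<open>The conditions on the end vertices are automatic: \<open>a # u\<close> and
  \<open>u @ [b]\<close> are factors as soon as \<open>a # u @ [b]\<close> is one.\<close>

lemma extension_edges_iff:
  assumes "u \<in> factors w n"
  shows "(s, t) \<in> extension_edges w u \<longleftrightarrow>
    (\<exists>a b. s = Inl a \<and> t = Inr b \<and> a # u @ [b] \<in> factors w (Suc (Suc n)))"
proof -
  have "a \<in> left_extensions w u \<and> b \<in> right_extensions w u"
    if "a # u @ [b] \<in> factors w (Suc (Suc n))" for a b
    using tl_in_factors[OF that] butlast_in_factors[OF that] length_factors[OF assms]
    by (simp add: left_extensions_def right_extensions_def butlast_append)
  then show ?thesis
    using length_factors[OF assms] by (auto simp: extension_edges_def)
qed

lemma finite_extension_edges:
  assumes "finite (range w)"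
  shows "finite (extension_edges w u)"
proof -
  interpret pair_graph "extension_graph w u"
    using assms by (rule pair_graph_extension_graph)
  show ?thesis using finite_arcs by (simp add: extension_graph_def)
qed

lemma complexity_Suc_Suc:
  fixes w :: "'a word"
  assumes "finite (range w)"
  shows "complexity w (Suc (Suc n)) = (\<Sum>u\<in>factors w n. card (extension_edges w u))"
proof -
  define f :: "'a list \<times> ('a + 'a) \<times> ('a + 'a) \<Rightarrow> 'a list" where
    "f = (\<lambda>(u, e). projl (fst e) # u @ [projr (snd e)])"
  have "factors w (Suc (Suc n)) = f ` Sigma (factors w n) (extension_edges w)"
  proof (intro equalityI subsetI)
    fix e assume e: "e \<in> factors w (Suc (Suc n))"
    define u where "u = butlast (tl e)"
    have u: "u \<in> factors w n"
      unfolding u_def using e by (intro butlast_in_factors tl_in_factors)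
    have eq: "e = hd e # u @ [last e]"
    proof (cases e)
      case (Cons a v)
      then show ?thesis using length_factors[OF e] by (cases v rule: rev_cases) (auto simp: u_def)
    qed (use length_factors[OF e] in simp)
    have "(Inl (hd e), Inr (last e)) \<in> extension_edges w u"
      using e eq unfolding extension_edges_iff[OF u] by auto
    then show "e \<in> f ` Sigma (factors w n) (extension_edges w)"
      using u eq by (intro image_eqI[of _ _ "(u, (Inl (hd e), Inr (last e)))"]) (auto simp: f_def)
  qed (auto simp: f_def extension_edges_iff)
  moreover have "inj_on f (Sigma (factors w n) (extension_edges w))"
    by (auto simp: inj_on_def f_def extension_edges_iff)
  ultimately show ?thesis
    using assms
    by (simp add: complexity_def card_image finite_factors finite_extension_edges)
qed

section \<open>Letter frequencies and bounded partial sums\<close>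

lemma sum_letters_eq_count:
  assumes "finite A" "range w \<subseteq> A"
  shows "(\<Sum>i<N. q (w i)) = (\<Sum>a\<in>A. q a * of_nat (count_list (subsequence w 0 N) a) :: 'r::comm_semiring_1)"
proof (induction N)
  case (Suc N)
  have "(\<Sum>a\<in>A. q a * of_nat (count_list (subsequence w 0 (Suc N)) a))
      = (\<Sum>a\<in>A. q a * of_nat (count_list (subsequence w 0 N) a) + (if a = w N then q a else 0))"
    by (intro sum.cong) (auto simp: subsequence_def algebra_simps)
  also have "\<dots> = (\<Sum>i<N. q (w i)) + q (w N)"
    using assms Suc by (auto simp: sum.distrib)
  finally show ?case by simp
qed (simp add: subsequence_def)

text \<open>The partial sum divided by \<open>N\<close>, grouped by letters, is the combination of
  prefix frequencies with weights \<open>q\<close>. It tends to the sum in question, and to 0 by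
  boundedness.\<close>

lemma frequency_sum_eq_0_if_bounded:
  assumes A: "finite A" "range w \<subseteq> A" and freq: "\<And>a. a \<in> A \<Longrightarrow> has_frequency w a"
    and bdd: "\<And>N. \<bar>\<Sum>i<N. q (w i)\<bar> \<le> B"
  shows "(\<Sum>a\<in>A. q a * frequency w a) = 0"
proof -
  have "(\<lambda>N. \<Sum>a\<in>A. q a * prefix_frequency w a N) \<longlonglongrightarrow> (\<Sum>a\<in>A. q a * frequency w a)"
    using freq unfolding has_frequency_def frequency_def
    by (intro tendsto_intros) (simp add: convergent_LIMSEQ_iff)
  moreover have "(\<lambda>N. \<Sum>a\<in>A. q a * prefix_frequency w a N) \<longlonglongrightarrow> 0"
  proof (rule tendsto_rabs_zero_cancel, rule tendsto_sandwich[where f = "\<lambda>_. 0"])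
    \<comment> \<open>For \<open>N = 0\<close> both sides are 0, as division by zero yields
      0.\<close>
    have "\<bar>\<Sum>a\<in>A. q a * prefix_frequency w a N\<bar> \<le> B / real N" for N
    proof -
      have "(\<Sum>a\<in>A. q a * prefix_frequency w a N) = (\<Sum>i<N. q (w i)) / real N"
        unfolding sum_letters_eq_count[OF A] by (simp add: prefix_frequency_def sum_divide_distrib)
      then show ?thesis using bdd[of N] by (simp add: divide_right_mono)
    qed
    then show "\<forall>\<^sub>F N in sequentially. \<bar>\<Sum>a\<in>A. q a * prefix_frequency w a N\<bar> \<le> B / real N"
      by simp
    show "(\<lambda>N. B / real N) \<longlonglongrightarrow> 0" by (rule lim_const_over_n)
  qed simp_all
  ultimately show ?thesis by (rule LIMSEQ_unique)
qed

section \<open>Decomposition of functions on factors\<close>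

lemma edge_function_decomposition:
  fixes w :: "nat word" and g :: "nat list \<Rightarrow> rat"
  assumes d: "d \<ge> 1" and w: "range w = {1..d}"
    and freq: "\<And>a. a \<in> {1..d} \<Longrightarrow> has_frequency w a"
    and ind: "\<And>q. (\<Sum>a\<in>{1..d}. real_of_rat (q a) * frequency w a) = 0 \<Longrightarrow> \<forall>a\<in>{1..d}. q a = 0"
    and card: "card (factors w (Suc n)) + (d - 1) = card (factors w (Suc (Suc n)))"
  shows "\<exists>q h. \<forall>e\<in>factors w (Suc (Suc n)). g e = q (hd e) + h (tl e) - h (butlast e)"
proof -
  let ?E = "factors w (Suc (Suc n))"
  let ?V = "factors w (Suc n)"
  define v where "v i = subsequence w i (i + Suc n)" for i
  define \<epsilon> where "\<epsilon> i = subsequence w i (i + Suc (Suc n))" for i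
  have v: "v i \<in> ?V" for i unfolding v_def by (rule subsequence_in_factors)
  have \<epsilon>: "\<epsilon> i \<in> ?E" "hd (\<epsilon> i) = w i" "tl (\<epsilon> i) = v (Suc i)" "butlast (\<epsilon> i) = v i" for i
  proof -
    show "\<epsilon> i \<in> ?E" unfolding \<epsilon>_def by (rule subsequence_in_factors)
    show "hd (\<epsilon> i) = w i" "tl (\<epsilon> i) = v (Suc i)"
      by (simp_all only: \<epsilon>_def v_def subsequence_Cons[of w i "Suc n"] list.sel)
    show "butlast (\<epsilon> i) = v i"
      by (simp only: \<epsilon>_def v_def subsequence_snoc[of w i "Suc n"] butlast_snoc)
  qed
  have fin: "finite (factors w m)" for m by (rule finite_factors) (simp add: w)
  \<comment> \<open>Normalising the vertex function to vanish at \<open>v 0\<close> removes the constants from the kernel and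
    makes the system square.\<close>
  define X :: "(nat list + nat) set" where "X = (?V - {v 0}) <+> {1..d}"
  \<comment> \<open>The rows are the images of the indicator functions of single factors and of
    single letters.\<close>
  define M :: "nat list + nat \<Rightarrow> nat list \<Rightarrow> rat" where
    "M x e = (case x of Inl y \<Rightarrow> of_bool (y = tl e) - of_bool (y = butlast e) | Inr a \<Rightarrow> of_bool (a = hd e))"
    for x e
  define h :: "(nat list + nat \<Rightarrow> rat) \<Rightarrow> nat list \<Rightarrow> rat" where
    "h c y = (if y = v 0 then 0 else c (Inl y))" for c y
  have MX: "(\<Sum>x\<in>X. c x * M x e) = c (Inr (hd e)) + h c (tl e) - h c (butlast e)" if e: "e \<in> ?E" for c e
  proof -
    have "(\<Sum>y\<in>?V - {v 0}. c (Inl y) * M (Inl y) e) = (\<Sum>y\<in>?V. h c y * M (Inl y) e)"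
      using fin by (intro sum.mono_neutral_cong_left) (auto simp: h_def)
    also have "\<dots> = (\<Sum>y\<in>?V. (if y = tl e then h c y else 0) - (if y = butlast e then h c y else 0))"
      by (intro sum.cong) (auto simp: M_def)
    also have "\<dots> = h c (tl e) - h c (butlast e)"
      using fin tl_in_factors[OF e] butlast_in_factors[OF e] by (simp add: sum_subtractf)
    finally have 1: "(\<Sum>y\<in>?V - {v 0}. c (Inl y) * M (Inl y) e) = h c (tl e) - h c (butlast e)" .
    have "hd e \<in> range w"
      using e by (metis factorsE list.sel(1) rangeI subsequence_Cons)
    then have "hd e \<in> {1..d}" using w by simp
    have "(\<Sum>a\<in>{1..d}. c (Inr a) * M (Inr a) e) = (\<Sum>a\<in>{1..d}. if a = hd e then c (Inr a) else 0)"
      by (intro sum.cong) (auto simp: M_def)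
    also have "\<dots> = c (Inr (hd e))" using \<open>hd e \<in> {1..d}\<close> by simp
    finally show ?thesis
      using 1 fin by (simp add: X_def sum.Plus)
  qed
  have "\<exists>c. \<forall>e\<in>?E. (\<Sum>x\<in>X. c x * M x e) = g e"
  proof (rule surjective_if_injective_square_system)
    show "finite X" using fin by (simp add: X_def)
    show "finite ?E" by (rule fin)
    \<comment> \<open>There are \<open>(card ?V - 1) + d\<close> unknowns; the subtractions of
      naturals are exact since \<open>card ?V\<close> and \<open>d\<close> are positive.\<close>
    have "card ?V \<ge> 1" using v[of 0] fin[of "Suc n"] by (metis One_nat_def Suc_leI card_gt_0_iff empty_iff)
    then show "card X = card ?E"
      using fin v[of 0] card d by (simp add: X_def card_Plus card_Diff_singleton)
    fix c x assume 0: "\<forall>e\<in>?E. (\<Sum>x\<in>X. c x * M x e) = 0" and x: "x \<in> X"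
    \<comment> \<open>The kernel equation at the factor of length \<open>n + 2\<close> starting at
      position \<open>i\<close>; it telescopes along \<open>w\<close>.\<close>
    have step: "c (Inr (w i)) = h c (v i) - h c (v (Suc i))" for i
      using 0 MX[OF \<epsilon>(1)[of i], of c] \<epsilon>[of i] by simp
    have "(\<Sum>i<N. c (Inr (w i))) = h c (v 0) - h c (v N)" for N
      unfolding step by (induction N) auto
    then have sum: "(\<Sum>i<N. c (Inr (w i))) = - h c (v N)" for N
      by (simp add: h_def)
    \<comment> \<open>There are only finitely many factors of length \<open>n + 1\<close>, so this
      bound is independent of \<open>N\<close>.\<close>
    define B where "B = Max ((\<lambda>y. \<bar>real_of_rat (h c y)\<bar>) ` ?V)"
    have "\<bar>\<Sum>i<N. real_of_rat (c (Inr (w i)))\<bar> \<le> B" for N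
    proof -
      have "\<bar>\<Sum>i<N. real_of_rat (c (Inr (w i)))\<bar> = \<bar>real_of_rat (h c (v N))\<bar>"
        using sum[of N] by (simp flip: of_rat_sum add: of_rat_minus)
      also have "\<dots> \<le> B" unfolding B_def using fin v by (intro Max_ge) auto
      finally show ?thesis .
    qed
    then have "(\<Sum>a\<in>{1..d}. real_of_rat (c (Inr a)) * frequency w a) = 0"
      using frequency_sum_eq_0_if_bounded[of "{1..d}" w "\<lambda>a. real_of_rat (c (Inr a))" B] freq w
      by simp
    then have q0: "\<forall>a\<in>{1..d}. c (Inr a) = 0" using ind[of "\<lambda>a. c (Inr a)"] by simp
    \<comment> \<open>Once \<open>q\<close> vanishes, the telescoped sum leaves only the value of
      \<open>h c\<close> at \<open>v i\<close>, and every factor of length \<open>n + 1\<close> is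
      some \<open>v i\<close>.\<close>
    have hv: "h c (v i) = 0" for i
    proof -
      have "c (Inr (w j)) = 0" for j using q0 w by (metis rangeI)
      then show ?thesis using sum[of i] by simp
    qed
    then have h0: "c (Inl y) = 0" if "y \<in> ?V - {v 0}" for y
    proof -
      obtain i where "y = v i" using \<open>y \<in> ?V - {v 0}\<close> by (auto simp only: v_def elim!: factorsE)
      then show ?thesis using hv[of i] that by (simp add: h_def)
    qed
    show "c x = 0" using x q0 h0 by (auto simp: X_def)
  qed
  then obtain c where "\<forall>e\<in>?E. (\<Sum>x\<in>X. c x * M x e) = g e" by blast
  then have "\<forall>e\<in>?E. g e = c (Inr (hd e)) + h c (tl e) - h c (butlast e)" using MX by simp
  then show ?thesis by (intro exI[of _ "\<lambda>a. c (Inr a)"] exI[of _ "h c"])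
qed

text \<open>On the word \<open>a # u @ [b]\<close> the term \<open>h (butlast e)\<close> depends on
  \<open>a\<close> only and \<open>h (tl e)\<close> on \<open>b\<close> only, so the decomposition
  splits into a left and a right potential.\<close>

lemma extension_edges_potential:
  fixes g :: "('a + 'a) \<times> ('a + 'a) \<Rightarrow> rat"
  assumes u: "u \<in> factors w n"
    and dec: "\<And>g :: 'a list \<Rightarrow> rat.
      \<exists>q h. \<forall>e\<in>factors w (Suc (Suc n)). g e = q (hd e) + h (tl e) - h (butlast e)"
  shows "\<exists>\<sigma>. \<forall>(s, t)\<in>extension_edges w u. g (s, t) = \<sigma> s - \<sigma> t"
proof -
  obtain q h where qh: "\<And>e. e \<in> factors w (Suc (Suc n)) \<Longrightarrow>
      g (Inl (hd e), Inr (last e)) = q (hd e) + h (tl e) - h (butlast e)"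
    using dec[of "\<lambda>e. g (Inl (hd e), Inr (last e))"] by blast
  define \<sigma> where "\<sigma> = case_sum (\<lambda>a. q a - h (a # u)) (\<lambda>b. - h (u @ [b]))"
  have "g (s, t) = \<sigma> s - \<sigma> t" if st: "(s, t) \<in> extension_edges w u" for s t
  proof -
    obtain a b where "s = Inl a" "t = Inr b" "a # u @ [b] \<in> factors w (Suc (Suc n))"
      using st extension_edges_iff[OF u] by auto
    then show ?thesis using qh[of "a # u @ [b]"] by (simp add: \<sigma>_def butlast_append)
  qed
  then show ?thesis by auto
qed

section \<open>The extension graphs are trees\<close>

theorem theorem3p2:
  fixes d :: nat and w :: "nat word"
  assumes "d \<ge> 1"
    and "infinite_dary_word d w"
    and "rationally_independent_frequencies d w"
    and "\<And>n. complexity w n = (d - 1) * n + 1"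
  shows "dendric w"
  unfolding dendric_def
proof (intro allI ballI)
  fix n u assume u: "u \<in> factors w n"
  have w: "range w = {1..d}" using assms(2) by (simp add: infinite_dary_word_def)
  then have fw: "finite (range w)" by simp
  have freq: "has_frequency w a" if "a \<in> {1..d}" for a
    using assms(3) that by (simp add: rationally_independent_frequencies_def)
  have ind: "\<forall>a\<in>{1..d}. q a = 0" if "(\<Sum>a\<in>{1..d}. real_of_rat (q a) * frequency w a) = 0" for q
    using assms(3) that rationally_independent_family_iff[of "{1..d}" "frequency w"]
    by (auto simp: rationally_independent_frequencies_def)
  have "card (factors w (Suc n)) + (d - 1) = card (factors w (Suc (Suc n)))"
    using assms(4)[of "Suc n"] assms(4)[of "Suc (Suc n)"] by (simp add: complexity_def)
  note dec = edge_function_decomposition[OF assms(1) w freq ind this]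
  have pot: "\<exists>\<sigma>. \<forall>(s, t)\<in>extension_edges w u. g (s, t) = \<sigma> s - \<sigma> t"
    if "u \<in> factors w n" for u and g :: "_ \<Rightarrow> rat"
    using that dec by (rule extension_edges_potential)

  let ?G = "extension_graph w"
  have pg: "pair_graph (?G u)" for u using fw by (rule pair_graph_extension_graph)
  have finV: "finite (pverts (?G u))" for u
  proof -
    interpret pair_graph "?G u" by (rule pg)
    show ?thesis by (rule finite_verts)
  qed
  have sub: "extension_edges w u \<subseteq> pverts (?G u) \<times> pverts (?G u)" for u
    by (auto simp: extension_graph_def extension_edges_def)
  have ne: "pverts (?G u) \<noteq> {}" if "u \<in> factors w n" for u
  proof -
    obtain i where i: "u = subsequence w i (i + n)" using \<open>u \<in> factors w n\<close> by (rule factorsE)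
    then have "w (i + n) \<in> right_extensions w u"
      using subsequence_in_factors[of w i "Suc n"] unfolding subsequence_snoc
      by (simp add: right_extensions_def)
    then show ?thesis by (auto simp: extension_graph_def)
  qed
  \<comment> \<open>A single vertex serves as \<open>D\<close>, with \<tau> constant; this is the
    edge bound for a forest.\<close>
  have le: "card (extension_edges w u) + 1 \<le> card (pverts (?G u))" if u: "u \<in> factors w n" for u
  proof -
    obtain x where x: "x \<in> pverts (?G u)" using ne[OF u] by blast
    have "card (extension_edges w u) + card {x} \<le> card (pverts (?G u))"
    proof (rule card_arcs_le_if_potentials[OF finV sub _ pot[OF u]])
      fix \<gamma> :: "_ \<Rightarrow> rat"
      show "\<exists>\<tau>. (\<forall>(s, t)\<in>extension_edges w u. \<tau> s = \<tau> t) \<and> (\<forall>y\<in>{x}. \<tau> y = \<gamma> y)"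
        by (intro exI[of _ "\<lambda>_. \<gamma> x"]) auto
    qed (use x in auto)
    then show ?thesis by simp
  qed
  \<comment> \<open>Edges over all \<open>u\<close> count the factors of length
    \<open>n + 2\<close>; vertices count those of length \<open>n + 1\<close> twice. As the
    complexity is affine in \<open>n\<close>, the bounds \<open>le\<close> have equal sums on both
    sides and hence are equalities.\<close>
  have "(\<Sum>u\<in>factors w n. card (extension_edges w u) + 1) = complexity w (Suc (Suc n)) + complexity w n"
    unfolding complexity_Suc_Suc[OF fw] by (simp only: sum.distrib complexity_def) simp
  also have "\<dots> = complexity w (Suc n) + complexity w (Suc n)"
    using assms(4)[of n] assms(4)[of "Suc n"] assms(4)[of "Suc (Suc n)"] by simp
  also have "\<dots> = (\<Sum>u\<in>factors w n. card (left_extensions w u) + card (right_extensions w u))"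
    by (simp only: sum.distrib complexity_Suc_left[OF fw, symmetric] complexity_Suc_right[OF fw, symmetric])
  also have "\<dots> = (\<Sum>u\<in>factors w n. card (pverts (?G u)))"
  proof (intro sum.cong refl)
    fix u
    have "pverts (?G u) = left_extensions w u <+> right_extensions w u"
      by (simp add: extension_graph_def Plus_def)
    with finV[of u] show "card (left_extensions w u) + card (right_extensions w u) = card (pverts (?G u))"
      by (simp add: card_Plus)
  qed
  finally have eq: "card (extension_edges w u) + 1 = card (pverts (?G u))"
    using le u finite_factors[OF fw, of n]
    by (metis (no_types, lifting) sum_mono_inv)
  have "Digraph_Component.connected (with_proj (?G u))"
  proof (rule ccontr)
    assume "\<not> Digraph_Component.connected (with_proj (?G u))"
    then obtain x y S where xy: "x \<in> pverts (?G u)" "y \<in> pverts (?G u)" "x \<in> S" "y \<notin> S"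
      and S: "\<And>s t. (s, t) \<in> parcs (?G u) \<Longrightarrow> s \<in> S \<longleftrightarrow> t \<in> S"
      using separated_if_not_connected[OF pg ne[OF u]] by metis
    \<comment> \<open>One vertex inside \<open>S\<close> and one outside improve the bound by one,
      against \<open>eq\<close>; \<tau> takes one value on \<open>S\<close> and another off
      it.\<close>
    have "card (extension_edges w u) + card {x, y} \<le> card (pverts (?G u))"
    proof (rule card_arcs_le_if_potentials[OF finV sub _ pot[OF u]])
      fix \<gamma> :: "_ \<Rightarrow> rat"
      have "s \<in> S \<longleftrightarrow> t \<in> S" if "(s, t) \<in> extension_edges w u" for s t
        using S[of s t] that by (simp add: extension_graph_def)
      then show "\<exists>\<tau>. (\<forall>(s, t)\<in>extension_edges w u. \<tau> s = \<tau> t) \<and> (\<forall>z\<in>{x, y}. \<tau> z = \<gamma> z)"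
        using xy by (intro exI[of _ "\<lambda>z. if z \<in> S then \<gamma> x else \<gamma> y"]) auto
    qed (use xy in auto)
    moreover have "x \<noteq> y" using xy by auto
    ultimately show False using eq by simp
  qed
  moreover have "undirected_acyclic (?G u)"
  proof (rule undirected_acyclic_if_separating_potentials)
    fix x y assume xy: "(x, y) \<in> parcs (?G u)"
    \<comment> \<open>The indicator of the undirected edge: \<open>extension_edges\<close> contains
      just the orientation from left to right, while the arc \<open>(x, y)\<close> may have either
      one.\<close>
    define g :: "(nat + nat) \<times> (nat + nat) \<Rightarrow> rat"
      where "g e = of_bool (e = (x, y) \<or> e = (y, x))" for e
    obtain \<sigma> where "\<forall>(s, t)\<in>extension_edges w u. g (s, t) = \<sigma> s - \<sigma> t"
      using pot[OF u, of g] by (elim exE)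
    then have \<sigma>: "g (s, t) = \<sigma> s - \<sigma> t" if "(s, t) \<in> extension_edges w u" for s t
      using that by blast
    have arcs: "(s, t) \<in> parcs (?G u) \<longleftrightarrow> (s, t) \<in> extension_edges w u \<or> (t, s) \<in> extension_edges w u" for s t
      by (auto simp: extension_graph_def)
    have "\<sigma> x \<noteq> \<sigma> y"
      using xy \<sigma>[of x y] \<sigma>[of y x] unfolding arcs g_def by auto
    moreover have "\<sigma> s = \<sigma> t" if "(s, t) \<in> parcs (?G u)" "(s, t) \<noteq> (x, y)" "(s, t) \<noteq> (y, x)" for s t
      using that \<sigma>[of s t] \<sigma>[of t s] unfolding arcs g_def by auto
    ultimately show "\<exists>\<sigma> :: _ \<Rightarrow> rat. \<sigma> x \<noteq> \<sigma> y \<and>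
      (\<forall>s t. (s, t) \<in> parcs (?G u) \<longrightarrow> (s, t) \<noteq> (x, y) \<longrightarrow> (s, t) \<noteq> (y, x) \<longrightarrow> \<sigma> s = \<sigma> t)"
      by blast
  qed
  ultimately show "undirected_tree (?G u)" by (simp add: undirected_tree_def)
qed

end
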